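(* Let $2<r<\infty$, let $\nu$ be an admissible function for the space $G(\nu;r)$ (see context), let $\xi\in G(\nu;r)$ be a random variable with $\mathbf{E}\xi=0$, and let $\xi(k)$, $k=1,2,\dots$, be independent copies of $\xi$. Then there is a constant $C(\nu;r)<\infty$ depending only on $\nu$ and $r$ such that $$\sup_{n}\left\|n^{-1/2}\sum_{k=1}^n\xi(k)\right\|_{G(\nu;r)}\le C(\nu;r)\,\|\xi\|_{G(\nu;r)}.$$ In particular, if $\nu_\xi(p)=|\xi|_p$ is the natural function of $\xi$ (with $|\xi|_p<\infty$ for $p<r$ and $|\xi|_p=\infty$ for $p>r$), then $$\|\xi\|_{G(\nu_\xi)}\le\sup_n\left\|n^{-1/2}\sum_{k=1}^n\xi(k)\right\|_{G(\nu_\xi)}\le C(\nu_\xi)\,\|\xi\|_{G(\nu_\xi)},$$ with a finite constant $C(\nu_\xi)$.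
   Context: Notation: $|\xi|_p=[\mathbf{E}|\xi|^p]^{1/p}$. Let $2<r<\infty$ and let $\nu$ be a continuous positive function on $[1,r)$ with $\inf_{p\in(2,r)}\nu(p)>0$, and $\nu(p)=\infty$ for $p>r$ (such $\nu$ is called admissible). The space $G(\nu)=G(\nu;r)$ consists of all random variables (on a fixed probability space) with finite norm $\|\xi\|_{G(\nu;r)}=\sup_{p\in(2,r)}|\xi|_p/\nu(p)$. *)

theory Defs
  imports "HOL-Probability.Probability"
begin

text \<open>\<open>(E |X| ^ p) ^ (1 / p)\<close> with values in \<open>[0, \<infinity>]\<close>; the case distinction is needed because
  the library has no real powers on \<^typ>\<open>ennreal\<close>.\<close>

definition Lp_norm :: "'a measure \<Rightarrow> real \<Rightarrow> ('a \<Rightarrow> real) \<Rightarrow> ennreal" where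
  "Lp_norm M p X =
    (let I = \<integral>\<^sup>+ \<omega>. ennreal (\<bar>X \<omega>\<bar> powr p) \<partial>M
     in if I = \<infinity> then \<infinity> else ennreal (enn2real I powr (1 / p)))"

text \<open>\<open>\<nu>\<close> takes values in \<open>[0, \<infinity>]\<close> so that \<open>\<nu> p = \<infinity>\<close> can be expressed for \<open>p > r\<close>; on \<open>[1, r)\<close> it is
  a finite positive continuous function. The value \<open>\<nu> r\<close> is left unconstrained.\<close>

definition admissible :: "(real \<Rightarrow> ennreal) \<Rightarrow> real \<Rightarrow> bool" where
  "admissible \<nu> r \<longleftrightarrow>
     (\<forall>p\<in>{1..<r}. 0 < \<nu> p \<and> \<nu> p < \<infinity>) \<and>
     continuous_on {1..<r} \<nu> \<and>
     0 < (INF p\<in>{2<..<r}. \<nu> p) \<and>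
     (\<forall>p>r. \<nu> p = \<infinity>)"

definition G_norm :: "'a measure \<Rightarrow> (real \<Rightarrow> ennreal) \<Rightarrow> real \<Rightarrow> ('a \<Rightarrow> real) \<Rightarrow> ennreal" where
  "G_norm M \<nu> r X = (SUP p\<in>{2<..<r}. Lp_norm M p X / \<nu> p)"

definition G_space :: "'a measure \<Rightarrow> (real \<Rightarrow> ennreal) \<Rightarrow> real \<Rightarrow> ('a \<Rightarrow> real) set" where
  "G_space M \<nu> r = {X \<in> borel_measurable M. G_norm M \<nu> r X < \<infinity>}"

definition natural_function :: "'a measure \<Rightarrow> ('a \<Rightarrow> real) \<Rightarrow> real \<Rightarrow> ennreal" where
  "natural_function M X = (\<lambda>p. Lp_norm M p X)"

text \<open>The copies are independent of each other; nothing is required about their joint law with \<open>\<xi>\<close>.\<close>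

definition independent_copies :: "'a measure \<Rightarrow> ('a \<Rightarrow> real) \<Rightarrow> (nat \<Rightarrow> 'a \<Rightarrow> real) \<Rightarrow> bool" where
  "independent_copies M \<xi> X \<longleftrightarrow>
     prob_space.indep_vars M (\<lambda>_. borel) X {1..} \<and>
     (\<forall>k\<ge>1. distr M borel (X k) = distr M borel \<xi>)"

definition normalized_sum :: "(nat \<Rightarrow> 'a \<Rightarrow> real) \<Rightarrow> nat \<Rightarrow> 'a \<Rightarrow> real" where
  "normalized_sum X n = (\<lambda>\<omega>. real n powr (- 1 / 2) * (\<Sum>k=1..n. X k \<omega>))"

end

theory Submission
  imports Defs
begin

text \<open>The norm of \<open>G(\<nu>; r)\<close> compares the \<open>L\<^sup>p\<close> norm with \<open>\<nu> p\<close> for one exponent \<open>p\<close> at a time, so the theorem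
  follows from one moment inequality for each \<open>p\<close>: for independent copies of a centred variable, the
  \<open>L\<^sup>p\<close> norm of the normalized sum is at most a constant times that of \<open>\<xi>\<close>, and the constant stays bounded as \<open>p\<close> runs through \<open>(2, r)\<close>. The
  constant of the theorem is then a function of \<open>r\<close> alone.

  The moment inequality (\<open>expectation_powr_sum_le\<close>) is proved by adding the variables one at a time,
  without symmetrization. Expand \<open>\<bar>Y + Z\<bar> powr p\<close> to second order in \<open>Z\<close> (\<open>abs_add_powr_le\<close>), where \<open>Y\<close> is
  the partial sum and \<open>Z\<close> the next variable. The first-order term has mean zero by independence and
  centring, and the remainder has mean at most a constant times
  \<open>E Z\<^sup>2 * E \<bar>Y\<bar> powr (p - 2) + E \<bar>Z\<bar> powr p\<close>. If the \<open>L\<^sup>p\<close> norms of \<open>Y\<close> and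
  \<open>Z\<close> are at most \<open>t\<close> and \<open>m\<close> with \<open>m \<le> t\<close>, this gives, with \<open>L\<close> depending on \<open>p\<close> only,
  \<open>E \<bar>Y + Z\<bar> powr p \<le> t powr (p - 2) * (t\<^sup>2 + L * m\<^sup>2) \<le> sqrt (t\<^sup>2 + L * m\<^sup>2) powr p\<close>.
  Hence each new variable raises the square of the bound on the norm by \<open>L * m\<^sup>2\<close>, and after \<open>n\<close> steps
  the norm is at most \<open>sqrt (L * n) * m\<close>, which is the rate that the factor \<open>n powr (- 1 / 2)\<close> cancels.

  In the second part of the theorem the lower bound is the term \<open>n = 1\<close> of the supremum.\<close>

section \<open>Inequalities for real powers\<close>

text \<open>The three summands serve different regimes of \<open>abs_add_powr_le\<close>: the last one the remainder for
  \<open>\<bar>b\<bar> \<le> \<bar>a\<bar>\<close>, the first two the crude bounds for \<open>\<bar>a\<bar> < \<bar>b\<bar>\<close>. Each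
  summand increases with \<open>p\<close>, which makes the value at \<open>r\<close> a bound for all \<open>p \<le> r\<close>.\<close>

definition taylor_const :: "real \<Rightarrow> real" where
  "taylor_const p = 2 powr p + p + p\<^sup>2 * exp p"

lemma taylor_const_pos: "0 \<le> p \<Longrightarrow> 0 < taylor_const p"
  unfolding taylor_const_def by (intro add_pos_nonneg) auto

lemma taylor_const_mono: "0 \<le> p \<Longrightarrow> p \<le> q \<Longrightarrow> taylor_const p \<le> taylor_const q"
  unfolding taylor_const_def
  by (intro add_mono mult_mono power_mono) auto

text \<open>Since \<open>1 + x \<le> exp x\<close>, the left side is at most \<open>exp (p * x)\<close>, and the Taylor
  expansion of the exponential function gives the quadratic remainder. In this way no derivative of a
  real power at \<open>0\<close> is involved when \<open>x = -1\<close>.\<close>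

lemma powr_one_plus_le:
  fixes p x :: real
  assumes "0 \<le> p" "\<bar>x\<bar> \<le> 1"
  shows "(1 + x) powr p \<le> 1 + p * x + p\<^sup>2 * exp p * x\<^sup>2"
proof -
  have "(1 + x) powr p \<le> exp x powr p"
    using assms by (intro powr_mono2) auto
  also have "\<dots> = exp (p * x)"
    by (simp add: powr_def mult.commute)
  finally have 1: "(1 + x) powr p \<le> exp (p * x)" .
  obtain t where t: "\<bar>t\<bar> \<le> \<bar>p * x\<bar>"
    "exp (p * x) = (\<Sum>m<2. (p * x) ^ m / fact m) + exp t / fact 2 * (p * x) ^ 2"
    using Maclaurin_exp_le[of "p * x" 2] by blast
  have "\<bar>p * x\<bar> \<le> p"
    using mult_left_mono[OF assms(2,1)] assms(1) by (simp add: abs_mult)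
  then have "t \<le> p" using t(1) by linarith
  then have "exp t / fact 2 \<le> exp p"
    using exp_ge_zero[of p] exp_le_cancel_iff[of t p] by (simp add: fact_2 del: exp_ge_zero exp_le_cancel_iff)
  then have "exp t / fact 2 * (p * x) ^ 2 \<le> exp p * (p * x)\<^sup>2"
    by (intro mult_right_mono) auto
  then show ?thesis
    using 1 t(2) by (simp add: eval_nat_numeral algebra_simps)
qed

text \<open>A second-order Taylor bound for \<open>\<lambda>x. \<bar>x\<bar> powr p\<close> at \<open>a\<close>. For \<open>\<bar>b\<bar> \<le> \<bar>a\<bar>\<close> it is the previous lemma
  rescaled by \<open>\<bar>a\<bar>\<close>; for larger \<open>b\<close> each of \<open>\<bar>a + b\<bar> powr p\<close> and the first-order term is at most
  a constant times \<open>\<bar>b\<bar> powr p\<close>.\<close>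

lemma abs_add_powr_le:
  fixes p a b :: real
  assumes p: "1 \<le> p"
  shows "\<bar>a + b\<bar> powr p \<le> \<bar>a\<bar> powr p + p * (b * (sgn a * \<bar>a\<bar> powr (p - 1)))
    + taylor_const p * (b\<^sup>2 * \<bar>a\<bar> powr (p - 2) + \<bar>b\<bar> powr p)"
proof (cases "\<bar>b\<bar> \<le> \<bar>a\<bar>")
  case True
  show ?thesis
  proof (cases "a = 0")
    case False
    define x where "x = b / a"
    have b: "b = x * a" using False by (simp add: x_def)
    have x: "\<bar>x\<bar> \<le> 1" using True False by (simp add: x_def)
    have e1: "\<bar>a + b\<bar> powr p = (1 + x) powr p * \<bar>a\<bar> powr p"
    proof -
      have "a + b = (1 + x) * a" by (simp add: b algebra_simps)
      then show ?thesis using x by (simp add: abs_mult powr_mult)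
    qed
    have e2: "b * (sgn a * \<bar>a\<bar> powr (p - 1)) = x * \<bar>a\<bar> powr p"
    proof -
      have "b * sgn a = x * \<bar>a\<bar>" using False by (cases "a > 0") (auto simp: b)
      then have "b * (sgn a * \<bar>a\<bar> powr (p - 1)) = x * (\<bar>a\<bar> * \<bar>a\<bar> powr (p - 1))"
        by (simp only: mult.assoc[symmetric])
      also have "\<bar>a\<bar> * \<bar>a\<bar> powr (p - 1) = \<bar>a\<bar> powr p"
        by (simp add: powr_mult_base)
      finally show ?thesis .
    qed
    have e3: "b\<^sup>2 * \<bar>a\<bar> powr (p - 2) = x\<^sup>2 * \<bar>a\<bar> powr p"
    proof -
      have "\<bar>a\<bar> powr p = \<bar>a\<bar> powr 2 * \<bar>a\<bar> powr (p - 2)"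
        by (subst powr_add[symmetric]) simp
      then show ?thesis by (simp add: b power_mult_distrib)
    qed
    have "\<bar>a + b\<bar> powr p \<le> (1 + p * x + p\<^sup>2 * exp p * x\<^sup>2) * \<bar>a\<bar> powr p"
      unfolding e1 using powr_one_plus_le[of p x] x p by (intro mult_right_mono) auto
    also have "\<dots> \<le> (1 + p * x + taylor_const p * x\<^sup>2) * \<bar>a\<bar> powr p"
      using p by (intro mult_right_mono add_left_mono) (auto simp: taylor_const_def)
    also have "\<dots> \<le> \<bar>a\<bar> powr p + p * (x * \<bar>a\<bar> powr p) + taylor_const p * (x\<^sup>2 * \<bar>a\<bar> powr p + \<bar>b\<bar> powr p)"
      using taylor_const_pos[of p] p by (simp add: algebra_simps)
    finally show ?thesis unfolding e2 e3 .
  qed (use True in simp)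
next
  case False
  have b: "\<bar>a\<bar> \<le> \<bar>b\<bar>" using False by simp
  have "\<bar>a + b\<bar> powr p \<le> (2 * \<bar>b\<bar>) powr p"
    using b p by (intro powr_mono2) auto
  then have 1: "\<bar>a + b\<bar> powr p \<le> 2 powr p * \<bar>b\<bar> powr p"
    by (simp add: powr_mult)
  have "\<bar>b * (sgn a * \<bar>a\<bar> powr (p - 1))\<bar> \<le> \<bar>b\<bar> powr 1 * \<bar>b\<bar> powr (p - 1)"
    using b p by (auto simp: abs_mult abs_sgn_eq intro!: mult_left_mono powr_mono2)
  then have "\<bar>b * (sgn a * \<bar>a\<bar> powr (p - 1))\<bar> \<le> \<bar>b\<bar> powr p"
    by (simp add: powr_mult_base)
  then have "- (\<bar>b\<bar> powr p) \<le> b * (sgn a * \<bar>a\<bar> powr (p - 1))"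
    by linarith
  then have 2: "p * - (\<bar>b\<bar> powr p) \<le> p * (b * (sgn a * \<bar>a\<bar> powr (p - 1)))"
    using p by (intro mult_left_mono) auto
  have "(2 powr p + p) * \<bar>b\<bar> powr p \<le> taylor_const p * (b\<^sup>2 * \<bar>a\<bar> powr (p - 2) + \<bar>b\<bar> powr p)"
    using p by (intro mult_mono) (auto simp: taylor_const_def)
  then have "2 powr p * \<bar>b\<bar> powr p + p * \<bar>b\<bar> powr p \<le> taylor_const p * (b\<^sup>2 * \<bar>a\<bar> powr (p - 2) + \<bar>b\<bar> powr p)"
    by (simp add: algebra_simps)
  then show ?thesis using 1 2 powr_ge_zero[of "\<bar>a\<bar>" p] by linarith
qed

text \<open>The second summand bounds the left side for \<open>s \<le> t\<close>, the first one for \<open>s > t\<close>. When \<open>t powr p\<close>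
  bounds the \<open>p\<close>-th moment, taking expectations replaces the inequality of Lyapunov
  between moments, at the price of a factor \<open>2\<close>.\<close>

lemma powr_le_add_powr:
  fixes s t p q :: real
  assumes "0 < t" "0 \<le> q" "q \<le> p" "0 \<le> s"
  shows "s powr q \<le> t powr (q - p) * s powr p + t powr q"
proof (cases "s \<le> t")
  case True
  then have "s powr q \<le> t powr q" using assms by (intro powr_mono2) auto
  then show ?thesis by (simp add: add_increasing)
next
  case False
  then have s: "t < s" "0 < s" using assms by auto
  have "s powr q = s powr (q - p) * s powr p" by (simp flip: powr_add)
  also have "\<dots> \<le> t powr (q - p) * s powr p"
    using s assms by (intro mult_right_mono powr_mono2') auto
  finally show ?thesis by (simp add: add_increasing2)
qed

section \<open>Moments of sums of independent centred variables\<close>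

context prob_space
begin

lemma integrable_powr_smaller:
  fixes Y :: "'a \<Rightarrow> real"
  assumes [measurable]: "random_variable borel Y"
    and int: "integrable M (\<lambda>\<omega>. \<bar>Y \<omega>\<bar> powr p)" and q: "0 \<le> q" "q \<le> p"
  shows "integrable M (\<lambda>\<omega>. \<bar>Y \<omega>\<bar> powr q)"
proof (rule Bochner_Integration.integrable_bound)
  show "integrable M (\<lambda>\<omega>. \<bar>Y \<omega>\<bar> powr p + 1)" using int by simp
  have "\<bar>Y \<omega>\<bar> powr q \<le> \<bar>Y \<omega>\<bar> powr p + 1" for \<omega>
    using powr_le_add_powr[of 1 q p "\<bar>Y \<omega>\<bar>"] q by simp
  then show "AE \<omega> in M. norm (\<bar>Y \<omega>\<bar> powr q) \<le> norm (\<bar>Y \<omega>\<bar> powr p + 1)"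
    by (auto simp: abs_of_nonneg)
qed simp

lemma expectation_powr_smaller_le:
  fixes Y :: "'a \<Rightarrow> real"
  assumes [measurable]: "random_variable borel Y"
    and int: "integrable M (\<lambda>\<omega>. \<bar>Y \<omega>\<bar> powr p)" and q: "0 \<le> q" "q \<le> p"
    and t: "0 < t" "expectation (\<lambda>\<omega>. \<bar>Y \<omega>\<bar> powr p) \<le> t powr p"
  shows "expectation (\<lambda>\<omega>. \<bar>Y \<omega>\<bar> powr q) \<le> 2 * t powr q"
proof -
  have "expectation (\<lambda>\<omega>. \<bar>Y \<omega>\<bar> powr q)
      \<le> expectation (\<lambda>\<omega>. t powr (q - p) * \<bar>Y \<omega>\<bar> powr p + t powr q)"
    using int integrable_powr_smaller[OF _ int q] powr_le_add_powr[OF t(1) q]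
    by (intro integral_mono) auto
  also have "\<dots> = t powr (q - p) * expectation (\<lambda>\<omega>. \<bar>Y \<omega>\<bar> powr p) + t powr q"
    using int by (simp add: prob_space)
  also have "\<dots> \<le> t powr (q - p) * t powr p + t powr q"
    using t(2) by (intro add_right_mono mult_left_mono) auto
  also have "\<dots> = 2 * t powr q" by (simp flip: powr_add)
  finally show ?thesis .
qed

lemma integrable_powr_add:
  fixes Y Z :: "'a \<Rightarrow> real"
  assumes [measurable]: "random_variable borel Y" "random_variable borel Z"
    and int: "integrable M (\<lambda>\<omega>. \<bar>Y \<omega>\<bar> powr p)" "integrable M (\<lambda>\<omega>. \<bar>Z \<omega>\<bar> powr p)" and p: "0 \<le> p"
  shows "integrable M (\<lambda>\<omega>. \<bar>Y \<omega> + Z \<omega>\<bar> powr p)"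
proof (rule Bochner_Integration.integrable_bound)
  show "integrable M (\<lambda>\<omega>. 2 powr p * (\<bar>Y \<omega>\<bar> powr p + \<bar>Z \<omega>\<bar> powr p))" using int by simp
  have "\<bar>y + z\<bar> powr p \<le> 2 powr p * (\<bar>y\<bar> powr p + \<bar>z\<bar> powr p)" for y z :: real
  proof -
    have "\<bar>y + z\<bar> powr p \<le> (2 * max \<bar>y\<bar> \<bar>z\<bar>) powr p" using p by (intro powr_mono2) auto
    also have "\<dots> = 2 powr p * max \<bar>y\<bar> \<bar>z\<bar> powr p" by (simp add: powr_mult)
    also have "\<dots> \<le> 2 powr p * (\<bar>y\<bar> powr p + \<bar>z\<bar> powr p)"
      by (intro mult_left_mono) (auto simp: max_def)
    finally show ?thesis .
  qed
  then show "AE \<omega> in M. norm (\<bar>Y \<omega> + Z \<omega>\<bar> powr p) \<le> norm (2 powr p * (\<bar>Y \<omega>\<bar> powr p + \<bar>Z \<omega>\<bar> powr p))"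
    by (auto simp: abs_of_nonneg)
qed simp

text \<open>Taking expectations in \<open>abs_add_powr_le\<close>. The factor \<open>5 = 2 * 2 + 1\<close> collects the bounds
  \<open>E Z\<^sup>2 \<le> 2 * m\<^sup>2\<close> and \<open>E \<bar>Y\<bar> powr (p - 2) \<le> 2 * t powr (p - 2)\<close>, and the last term \<open>E \<bar>Z\<bar> powr p\<close>, which
  is at most \<open>t powr (p - 2) * m\<^sup>2\<close> since \<open>m \<le> t\<close>.\<close>

lemma expectation_powr_add_le:
  fixes Y Z :: "'a \<Rightarrow> real"
  assumes indep: "indep_var borel Z borel Y" and p: "2 \<le> p"
    and intY: "integrable M (\<lambda>\<omega>. \<bar>Y \<omega>\<bar> powr p)" and intZ: "integrable M (\<lambda>\<omega>. \<bar>Z \<omega>\<bar> powr p)"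
    and mean: "expectation Z = 0"
    and t: "0 < m" "m \<le> t" "expectation (\<lambda>\<omega>. \<bar>Y \<omega>\<bar> powr p) \<le> t powr p"
      "expectation (\<lambda>\<omega>. \<bar>Z \<omega>\<bar> powr p) \<le> m powr p"
  shows "expectation (\<lambda>\<omega>. \<bar>Y \<omega> + Z \<omega>\<bar> powr p) \<le> t powr p + 5 * taylor_const p * (t powr (p - 2) * m\<^sup>2)"
proof -
  have [measurable]: "random_variable borel Y" "random_variable borel Z"
    using indep_var_rv1[OF indep] indep_var_rv2[OF indep] by auto
  note small = integrable_powr_smaller[OF _ intY] integrable_powr_smaller[OF _ intZ]
  have intZ1: "integrable M Z"
    using small(2)[of 1] p by (simp add: integrable_abs_iff)
  have intZ2: "integrable M (\<lambda>\<omega>. (Z \<omega>)\<^sup>2)"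
    using small(2)[of 2] p by simp
  have intY1: "integrable M (\<lambda>\<omega>. sgn (Y \<omega>) * \<bar>Y \<omega>\<bar> powr (p - 1))"
    by (rule Bochner_Integration.integrable_bound[OF small(1)[of "p - 1"]])
       (use p in \<open>auto simp: abs_mult abs_sgn_eq\<close>)
  have intY2: "integrable M (\<lambda>\<omega>. \<bar>Y \<omega>\<bar> powr (p - 2))"
    using small(1)[of "p - 2"] p by simp
  have ind1: "indep_var borel Z borel (\<lambda>\<omega>. sgn (Y \<omega>) * \<bar>Y \<omega>\<bar> powr (p - 1))"
    using indep_var_compose[OF indep, of "\<lambda>x. x" borel "\<lambda>x. sgn x * \<bar>x\<bar> powr (p - 1)" borel]
    by (simp add: comp_def)
  have ind2: "indep_var borel (\<lambda>\<omega>. (Z \<omega>)\<^sup>2) borel (\<lambda>\<omega>. \<bar>Y \<omega>\<bar> powr (p - 2))"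
    using indep_var_compose[OF indep, of "\<lambda>x. x\<^sup>2" borel "\<lambda>x. \<bar>x\<bar> powr (p - 2)" borel]
    by (simp add: comp_def)
  note int1 = indep_var_integrable[OF ind1 intZ1 intY1] and int2 = indep_var_integrable[OF ind2 intZ2 intY2]
  have "expectation (\<lambda>\<omega>. \<bar>Y \<omega> + Z \<omega>\<bar> powr p)
    \<le> expectation (\<lambda>\<omega>. \<bar>Y \<omega>\<bar> powr p + p * (Z \<omega> * (sgn (Y \<omega>) * \<bar>Y \<omega>\<bar> powr (p - 1)))
        + taylor_const p * ((Z \<omega>)\<^sup>2 * \<bar>Y \<omega>\<bar> powr (p - 2) + \<bar>Z \<omega>\<bar> powr p))"
    using p int1 int2 intY intZ
    by (intro integral_mono integrable_powr_add abs_add_powr_le) auto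
  also have "\<dots> = expectation (\<lambda>\<omega>. \<bar>Y \<omega>\<bar> powr p)
        + p * expectation (\<lambda>\<omega>. Z \<omega> * (sgn (Y \<omega>) * \<bar>Y \<omega>\<bar> powr (p - 1)))
        + taylor_const p * (expectation (\<lambda>\<omega>. (Z \<omega>)\<^sup>2 * \<bar>Y \<omega>\<bar> powr (p - 2)) + expectation (\<lambda>\<omega>. \<bar>Z \<omega>\<bar> powr p))"
    using int1 int2 intY intZ by simp
  also have "expectation (\<lambda>\<omega>. Z \<omega> * (sgn (Y \<omega>) * \<bar>Y \<omega>\<bar> powr (p - 1))) = 0"
    using indep_var_lebesgue_integral[OF ind1 intZ1 intY1] mean by simp
  also have "expectation (\<lambda>\<omega>. (Z \<omega>)\<^sup>2 * \<bar>Y \<omega>\<bar> powr (p - 2))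
      = expectation (\<lambda>\<omega>. (Z \<omega>)\<^sup>2) * expectation (\<lambda>\<omega>. \<bar>Y \<omega>\<bar> powr (p - 2))"
    by (rule indep_var_lebesgue_integral[OF ind2 intZ2 intY2])
  finally have 1: "expectation (\<lambda>\<omega>. \<bar>Y \<omega> + Z \<omega>\<bar> powr p) \<le> expectation (\<lambda>\<omega>. \<bar>Y \<omega>\<bar> powr p)
     + taylor_const p * (expectation (\<lambda>\<omega>. (Z \<omega>)\<^sup>2) * expectation (\<lambda>\<omega>. \<bar>Y \<omega>\<bar> powr (p - 2))
         + expectation (\<lambda>\<omega>. \<bar>Z \<omega>\<bar> powr p))" by simp
  have EY: "expectation (\<lambda>\<omega>. \<bar>Y \<omega>\<bar> powr (p - 2)) \<le> 2 * t powr (p - 2)"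
    by (rule expectation_powr_smaller_le[OF _ intY]) (use p t in auto)
  have EZ: "expectation (\<lambda>\<omega>. (Z \<omega>)\<^sup>2) \<le> 2 * m\<^sup>2"
    using expectation_powr_smaller_le[OF _ intZ, of 2 m] p t by simp
  have "m powr p = m powr (p - 2) * m powr 2" by (simp flip: powr_add)
  also have "\<dots> \<le> t powr (p - 2) * m\<^sup>2"
    using p t by (auto intro!: mult_right_mono powr_mono2)
  finally have mp: "m powr p \<le> t powr (p - 2) * m\<^sup>2" .
  have "expectation (\<lambda>\<omega>. (Z \<omega>)\<^sup>2) * expectation (\<lambda>\<omega>. \<bar>Y \<omega>\<bar> powr (p - 2)) + expectation (\<lambda>\<omega>. \<bar>Z \<omega>\<bar> powr p)
     \<le> 2 * m\<^sup>2 * (2 * t powr (p - 2)) + t powr (p - 2) * m\<^sup>2"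
    using t(4) mp by (intro add_mono mult_mono EZ EY) (auto intro!: integral_nonneg_AE)
  then have "taylor_const p * (expectation (\<lambda>\<omega>. (Z \<omega>)\<^sup>2) * expectation (\<lambda>\<omega>. \<bar>Y \<omega>\<bar> powr (p - 2)) + expectation (\<lambda>\<omega>. \<bar>Z \<omega>\<bar> powr p))
     \<le> taylor_const p * (2 * m\<^sup>2 * (2 * t powr (p - 2)) + t powr (p - 2) * m\<^sup>2)"
    using taylor_const_pos[of p] p by (intro mult_left_mono) auto
  then show ?thesis using 1 t(3) by (simp add: algebra_simps)
qed

text \<open>The rate \<open>sqrt (card I)\<close> reproduces itself: if \<open>t\<close> is the bound for \<open>I\<close> and \<open>t'\<close> the one for
  \<open>insert i I\<close>, then \<open>t'\<^sup>2 = t\<^sup>2 + L * m\<^sup>2\<close>, so the bound of \<open>expectation_powr_add_le\<close> equals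
  \<open>t powr (p - 2) * t'\<^sup>2\<close>, which is at most \<open>t' powr p\<close>. Integrability is part of the induction, because
  a Bochner integral that does not exist is \<open>0\<close> and would make the bound void.\<close>

lemma expectation_powr_sum_le:
  fixes X :: "'i \<Rightarrow> 'a \<Rightarrow> real"
  assumes "finite I" and p: "2 \<le> p" and m: "0 < m"
    and "indep_vars (\<lambda>_. borel) X I"
    and "\<And>i. i \<in> I \<Longrightarrow> integrable M (\<lambda>\<omega>. \<bar>X i \<omega>\<bar> powr p)"
    and "\<And>i. i \<in> I \<Longrightarrow> expectation (\<lambda>\<omega>. \<bar>X i \<omega>\<bar> powr p) \<le> m powr p"
    and "\<And>i. i \<in> I \<Longrightarrow> expectation (X i) = 0"
  shows "integrable M (\<lambda>\<omega>. \<bar>\<Sum>i\<in>I. X i \<omega>\<bar> powr p) \<and>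
    expectation (\<lambda>\<omega>. \<bar>\<Sum>i\<in>I. X i \<omega>\<bar> powr p) \<le> (sqrt (5 * taylor_const p * card I) * m) powr p"
  using assms(1,4-7)
proof (induction I rule: finite_induct)
  case (insert i I)
  define L where "L = 5 * taylor_const p"
  have "1 \<le> taylor_const p"
    unfolding taylor_const_def
    using p ge_one_powr_ge_zero[of 2 p] mult_nonneg_nonneg[of "p\<^sup>2" "exp p"]
      zero_le_power2[of p] exp_ge_zero[of p] by linarith
  then have L: "1 \<le> L" by (simp add: L_def)
  define S where "S = (\<lambda>\<omega>. \<Sum>i\<in>I. X i \<omega>)"
  define t where "t = sqrt (L * card I) * m"
  have [measurable]: "random_variable borel (X j)" if "j \<in> insert i I" for j
    using insert.prems(1) that by (auto simp: indep_vars_def)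
  have S[measurable]: "random_variable borel S" unfolding S_def by measurable
  have IH: "integrable M (\<lambda>\<omega>. \<bar>S \<omega>\<bar> powr p)" "expectation (\<lambda>\<omega>. \<bar>S \<omega>\<bar> powr p) \<le> t powr p"
    using insert.IH[OF indep_vars_subset[OF insert.prems(1)]] insert.prems
    by (auto simp: S_def t_def L_def)
  have indep: "indep_var borel (X i) borel S"
    unfolding S_def using insert by (intro indep_vars_sum) auto
  have sum: "(\<Sum>j\<in>insert i I. X j \<omega>) = S \<omega> + X i \<omega>" for \<omega>
    using insert by (simp add: S_def add.commute)
  have "integrable M (\<lambda>\<omega>. \<bar>S \<omega> + X i \<omega>\<bar> powr p)"
    using insert.prems p IH by (intro integrable_powr_add) auto
  moreover have "expectation (\<lambda>\<omega>. \<bar>S \<omega> + X i \<omega>\<bar> powr p) \<le> (sqrt (L * card (insert i I)) * m) powr p"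
    \<comment> \<open>A single variable is treated apart because then \<open>t = 0\<close>, which violates \<open>m \<le> t\<close>.\<close>
  proof (cases "I = {}")
    case True
    have "expectation (\<lambda>\<omega>. \<bar>S \<omega> + X i \<omega>\<bar> powr p) \<le> m powr p"
      using insert.prems(3)[of i] by (simp add: S_def True)
    also have "\<dots> \<le> (sqrt L * m) powr p"
      using m L p by (intro powr_mono2) auto
    finally show ?thesis using True by simp
  next
    case False
    then have c: "1 \<le> real (card I)" using insert by (simp add: Suc_le_eq card_gt_0_iff)
    have "1 * 1 \<le> L * card I" using L c by (intro mult_mono) auto
    then have mt: "m \<le> t" using m by (simp add: t_def)
    have t0: "0 < t" using mt m by simp
    define t' where "t' = sqrt (L * card (insert i I)) * m"
    have t'2: "t'\<^sup>2 = t\<^sup>2 + L * m\<^sup>2"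
      using L insert by (simp add: t'_def t_def power_mult_distrib algebra_simps)
    have tt': "t \<le> t'"
      using L m insert by (auto simp: t'_def t_def intro!: mult_right_mono mult_left_mono)
    have "expectation (\<lambda>\<omega>. \<bar>S \<omega> + X i \<omega>\<bar> powr p) \<le> t powr p + L * (t powr (p - 2) * m\<^sup>2)"
      unfolding L_def using insert.prems IH mt m p by (intro expectation_powr_add_le indep) auto
    also have "t powr p = t powr (p - 2) * t powr 2" by (simp flip: powr_add)
    also have "t powr (p - 2) * t powr 2 + L * (t powr (p - 2) * m\<^sup>2) = t powr (p - 2) * t'\<^sup>2"
      using t0 by (simp add: t'2 algebra_simps)
    also have "\<dots> \<le> t' powr (p - 2) * t' powr 2"
      using t0 tt' p by (auto intro!: mult_right_mono powr_mono2)
    also have "\<dots> = t' powr p" by (simp flip: powr_add)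
    finally show ?thesis by (simp add: t'_def)
  qed
  ultimately show ?case unfolding sum L_def by simp
qed (use p in simp)

end

section \<open>Normalized sums and the norms \<open>Lp_norm\<close> and \<open>G_norm\<close>\<close>

lemma Lp_norm_le_iff:
  assumes "0 < p" "0 \<le> m"
  shows "Lp_norm M p X \<le> ennreal m \<longleftrightarrow> (\<integral>\<^sup>+ \<omega>. ennreal (\<bar>X \<omega>\<bar> powr p) \<partial>M) \<le> ennreal (m powr p)"
proof (cases "\<integral>\<^sup>+ \<omega>. ennreal (\<bar>X \<omega>\<bar> powr p) \<partial>M" rule: ennreal_cases)
  case (real x)
  have "x powr (1 / p) \<le> m \<longleftrightarrow> x \<le> m powr p"
  proof
    assume "x powr (1 / p) \<le> m"
    then have "(x powr (1 / p)) powr p \<le> m powr p"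
      using assms by (intro powr_mono2) auto
    then show "x \<le> m powr p" using assms real by (simp add: powr_powr)
  next
    assume "x \<le> m powr p"
    then have "x powr (1 / p) \<le> (m powr p) powr (1 / p)"
      using assms real by (intro powr_mono2) auto
    then show "x powr (1 / p) \<le> m" using assms by (simp add: powr_powr)
  qed
  then show ?thesis using real assms by (simp add: Lp_norm_def)
next
  case top
  then show ?thesis by (simp add: Lp_norm_def top_unique)
qed

lemma Lp_norm_eq_of_distr_eq:
  assumes [measurable]: "X \<in> borel_measurable M" "Y \<in> borel_measurable M"
    and "distr M borel X = distr M borel Y"
  shows "Lp_norm M p X = Lp_norm M p Y"
proof -
  have "(\<integral>\<^sup>+ \<omega>. ennreal (\<bar>Z \<omega>\<bar> powr p) \<partial>M) = (\<integral>\<^sup>+ x. ennreal (\<bar>x\<bar> powr p) \<partial>distr M borel Z)"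
    if [measurable]: "Z \<in> borel_measurable M" for Z
    by (simp add: nn_integral_distr)
  then show ?thesis using assms by (simp add: Lp_norm_def)
qed

lemma (in prob_space) Lp_norm_le_moment:
  assumes [measurable]: "random_variable borel X"
    and "0 < p" "0 \<le> m" "Lp_norm M p X \<le> ennreal m"
  shows "integrable M (\<lambda>\<omega>. \<bar>X \<omega>\<bar> powr p)" "expectation (\<lambda>\<omega>. \<bar>X \<omega>\<bar> powr p) \<le> m powr p"
proof -
  have le: "(\<integral>\<^sup>+ \<omega>. ennreal (\<bar>X \<omega>\<bar> powr p) \<partial>M) \<le> ennreal (m powr p)"
    using assms by (simp add: Lp_norm_le_iff)
  show int: "integrable M (\<lambda>\<omega>. \<bar>X \<omega>\<bar> powr p)"
    by (intro integrableI_bounded) (use le in \<open>auto intro: le_less_trans\<close>)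
  show "expectation (\<lambda>\<omega>. \<bar>X \<omega>\<bar> powr p) \<le> m powr p"
    using le int by (simp add: nn_integral_eq_integral)
qed

definition moment_const :: "real \<Rightarrow> real" where
  "moment_const r = sqrt (5 * taylor_const r)"

text \<open>The moment inequality is applied with every \<open>m\<close> strictly above the norm of \<open>\<xi>\<close>, followed by
  \<open>m\<close> tending to that norm: this covers \<open>\<xi> = 0\<close> a.e., where the norm itself is not a positive
  \<open>m\<close>.\<close>

lemma (in prob_space) Lp_norm_normalized_sum_le:
  assumes \<xi>[measurable]: "random_variable borel \<xi>" and mean: "expectation \<xi> = 0"
    and copies: "independent_copies M \<xi> X" and p: "2 \<le> p" "p \<le> r" and n: "1 \<le> n"
  shows "Lp_norm M p (normalized_sum X n) \<le> ennreal (moment_const r) * Lp_norm M p \<xi>"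
proof (cases "Lp_norm M p \<xi>" rule: ennreal_cases)
  case (real c)
  have K: "0 < moment_const r"
    using taylor_const_pos[of r] p by (simp add: moment_const_def)
  have indep: "indep_vars (\<lambda>_. borel) X {1..n}"
    using copies by (auto simp: independent_copies_def intro: indep_vars_subset)
  then have X[measurable]: "random_variable borel (X k)" if "k \<in> {1..n}" for k
    using that by (auto simp: indep_vars_def)
  have distr: "distr M borel (X k) = distr M borel \<xi>" if "k \<in> {1..n}" for k
    using copies that by (auto simp: independent_copies_def)
  have bound: "Lp_norm M p (normalized_sum X n) \<le> ennreal (moment_const r * m)" if m: "c < m" for m
  proof -
    have m0: "0 < m" using m real by linarith
    have "Lp_norm M p (X k) \<le> ennreal m" if "k \<in> {1..n}" for k
      using Lp_norm_eq_of_distr_eq[OF X[OF that] \<xi> distr[OF that], of p] real m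
      by (simp add: ennreal_leI)
    note mom = Lp_norm_le_moment[OF X _ _ this]
    have meanX: "expectation (X k) = 0" if "k \<in> {1..n}" for k
      using integral_distr[OF X[OF that], of "\<lambda>x. x"] integral_distr[OF \<xi>, of "\<lambda>x. x"]
        distr[OF that] mean by simp
    define S where "S = (\<lambda>\<omega>. \<Sum>k\<in>{1..n}. X k \<omega>)"
    have [measurable]: "random_variable borel S" unfolding S_def by measurable
    have S: "integrable M (\<lambda>\<omega>. \<bar>S \<omega>\<bar> powr p)"
        "expectation (\<lambda>\<omega>. \<bar>S \<omega>\<bar> powr p) \<le> (sqrt (5 * taylor_const p * n) * m) powr p"
      using expectation_powr_sum_le[OF _ p(1) m0 indep mom(1) mom(2) meanX] m0 p
      by (auto simp: S_def)
    have sn: "\<bar>normalized_sum X n \<omega>\<bar> = \<bar>S \<omega>\<bar> / sqrt n" for \<omega>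
      by (simp add: normalized_sum_def S_def powr_minus powr_half_sqrt abs_mult divide_simps)
    then have eq: "\<bar>normalized_sum X n \<omega>\<bar> powr p = \<bar>S \<omega>\<bar> powr p / sqrt n powr p" for \<omega>
      by (simp add: powr_divide)
    have "(sqrt (5 * taylor_const p * n) * m) powr p / sqrt n powr p
        = (sqrt (5 * taylor_const p) * m) powr p"
      using n m0 taylor_const_pos[of p] p
      by (simp flip: powr_divide add: real_sqrt_mult mult.assoc)
    also have "\<dots> \<le> (moment_const r * m) powr p"
      using m0 p taylor_const_pos[of p] taylor_const_mono[of p r]
      by (auto simp: moment_const_def intro!: powr_mono2 mult_right_mono)
    finally have "(sqrt (5 * taylor_const p * n) * m) powr p / sqrt n powr p \<le> (moment_const r * m) powr p" .
    moreover have "expectation (\<lambda>\<omega>. \<bar>S \<omega>\<bar> powr p / sqrt n powr p)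
      \<le> (sqrt (5 * taylor_const p * n) * m) powr p / sqrt n powr p"
      using S(2) by (simp add: divide_right_mono)
    ultimately have "expectation (\<lambda>\<omega>. \<bar>S \<omega>\<bar> powr p / sqrt n powr p) \<le> (moment_const r * m) powr p"
      by linarith
    then have "(\<integral>\<^sup>+ \<omega>. ennreal (\<bar>normalized_sum X n \<omega>\<bar> powr p) \<partial>M) \<le> ennreal ((moment_const r * m) powr p)"
      using S(1) unfolding eq by (subst nn_integral_eq_integral) (auto intro: ennreal_leI)
    then show ?thesis
      using K m0 p by (subst Lp_norm_le_iff) auto
  qed
  have "Lp_norm M p (normalized_sum X n) \<le> ennreal (moment_const r * c) + ennreal e" if "0 < e" for e
  proof -
    have "Lp_norm M p (normalized_sum X n) \<le> ennreal (moment_const r * (c + e / moment_const r))"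
      using bound[of "c + e / moment_const r"] that K by simp
    also have "moment_const r * (c + e / moment_const r) = moment_const r * c + e"
      using K by (simp add: field_simps)
    finally show ?thesis using that K real by simp
  qed
  then have "Lp_norm M p (normalized_sum X n) \<le> ennreal (moment_const r * c)"
    by (rule ennreal_le_epsilon)
  then show ?thesis using K real by (simp add: ennreal_mult)
next
  case top
  then show ?thesis
    using taylor_const_pos[of r] p by (simp add: moment_const_def ennreal_mult_top)
qed

lemma (in prob_space) G_norm_normalized_sum_le:
  assumes "random_variable borel \<xi>" "expectation \<xi> = 0" "independent_copies M \<xi> X"
  shows "(SUP n\<in>{1..}. G_norm M \<nu> r (normalized_sum X n)) \<le> ennreal (moment_const r) * G_norm M \<nu> r \<xi>"
proof -
  have "Lp_norm M p (normalized_sum X n) / \<nu> p \<le> ennreal (moment_const r) * (Lp_norm M p \<xi> / \<nu> p)"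
    if "p \<in> {2<..<r}" "1 \<le> n" for p n
    unfolding ennreal_times_divide using assms that
    by (intro divide_right_mono_ennreal Lp_norm_normalized_sum_le) auto
  then show ?thesis
    unfolding G_norm_def SUP_mult_left_ennreal
    by (intro SUP_least SUP_mono) (meson atLeast_iff)
qed

lemma (in prob_space) G_norm_le_SUP_normalized_sum:
  assumes [measurable]: "random_variable borel \<xi>" and copies: "independent_copies M \<xi> X"
  shows "G_norm M \<nu> r \<xi> \<le> (SUP n\<in>{1..}. G_norm M \<nu> r (normalized_sum X n))"
proof -
  have "normalized_sum X 1 = X 1"
    by (simp add: normalized_sum_def)
  moreover have "random_variable borel (X 1)" "distr M borel (X 1) = distr M borel \<xi>"
    using copies by (auto simp: independent_copies_def indep_vars_def)
  ultimately have "G_norm M \<nu> r \<xi> = G_norm M \<nu> r (normalized_sum X 1)"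
    using Lp_norm_eq_of_distr_eq[of "X 1" M \<xi>] by (simp add: G_norm_def)
  then show ?thesis using SUP_upper[of 1 "{1..}" "\<lambda>n. G_norm M \<nu> r (normalized_sum X n)"] by simp
qed

theorem theorem4p1:
  shows "\<exists>C :: (real \<Rightarrow> ennreal) \<Rightarrow> real \<Rightarrow> ennreal.
    (\<forall>\<nu> r. 2 < r \<longrightarrow> admissible \<nu> r \<longrightarrow>
       C \<nu> r < \<infinity> \<and>
       (\<forall>(M :: 'a measure) \<xi> X.
          prob_space M \<longrightarrow> \<xi> \<in> G_space M \<nu> r \<longrightarrow> integral\<^sup>L M \<xi> = 0 \<longrightarrow>
          independent_copies M \<xi> X \<longrightarrow>
          (SUP n\<in>{1..}. G_norm M \<nu> r (normalized_sum X n)) \<le> C \<nu> r * G_norm M \<nu> r \<xi>)) \<and>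
    (\<forall>r (M :: 'a measure) \<xi> X.
       2 < r \<longrightarrow> prob_space M \<longrightarrow> \<xi> \<in> borel_measurable M \<longrightarrow> integral\<^sup>L M \<xi> = 0 \<longrightarrow>
       (\<forall>p\<in>{1..<r}. Lp_norm M p \<xi> < \<infinity>) \<longrightarrow> (\<forall>p>r. Lp_norm M p \<xi> = \<infinity>) \<longrightarrow>
       independent_copies M \<xi> X \<longrightarrow>
       C (natural_function M \<xi>) r < \<infinity> \<and>
       G_norm M (natural_function M \<xi>) r \<xi>
         \<le> (SUP n\<in>{1..}. G_norm M (natural_function M \<xi>) r (normalized_sum X n)) \<and>
       (SUP n\<in>{1..}. G_norm M (natural_function M \<xi>) r (normalized_sum X n))
         \<le> C (natural_function M \<xi>) r * G_norm M (natural_function M \<xi>) r \<xi>)"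
  by (rule exI[of _ "\<lambda>\<nu> r. ennreal (moment_const r)"])
     (auto simp: G_space_def simp del: One_nat_def intro: prob_space.G_norm_normalized_sum_le prob_space.G_norm_le_SUP_normalized_sum)

end
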